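(* Let $\mathscr{C}$ be a class closed under inverse length increasing morphisms, let $\eta:A^*\to M$ be a morphism into a finite monoid $M$, and let $s$ be the stability index of $\eta$. For every language $L_1$ and every finite multiset of languages $\mathbf{L}_2$, all recognized by $\eta$, the following are equivalent: (1) $(L_1,\mathbf{L}_2)$ is $[\mathscr{C}]$-coverable; (2) $(L_1,\mathbf{L}_2)$ is $[\mathscr{C}]_s$-coverable; (3) $(L_1^{\mathrm{sf}},\mathbf{L}_2^{\mathrm{sf}})$ is $\mathscr{C}$-coverable.
   Context: A class $\mathscr{C}$ assigns to each alphabet $A$ a set $\mathscr{C}(A)$ of regular languages over $A$. It is closed under inverse length increasing morphisms if for every monoid morphism $\alpha:A^*\to B^*$ with $\alpha(a)\neq\varepsilon$ for all $a\in A$ and every $L\in\mathscr{C}(B)$, $\alpha^{-1}(L)\in\mathscr{C}(A)$. A morphism $\eta:A^*\to M$ recognizes $L$ if $L=\eta^{-1}(\eta(L))$. Block abstraction: for $d\ge1$, $A_d$ is the alphabet whose letters are the nonempty words over $A$ of length at most $d$; $\mu_d:A^*\to A_d^*$ cuts $w$ into consecutive factors of length $d$ from the left, the last factor being of length $<d$ and omitted if empty, and returns the sequence of these factors as letters. $[\mathscr{C}]_d(A)=\{\mu_d^{-1}(K)\mid K\in\mathscr{C}(A_d)\}$, $[\mathscr{C}](A)=\bigcup_{d\ge1}[\mathscr{C}]_d(A)$. Stably-formed words: the stability index of $\eta$ is the least $s\ge1$ with $\eta(A^s)=\eta(A^{2s})$ (it exists). The alphabet $\mathbb{S}_\eta$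 has one letter $(x)$ for each $x\in\eta(A^+)$, and $\mathrm{ev}:\mathbb{S}_\eta^*\to M$ is the morphism with $\mathrm{ev}((x))=x$. A word of $\mathbb{S}_\eta^*$ is stably-formed if it is empty or equals $(x_1)\cdots(x_n)$ with $x_1,\dots,x_{n-1}\in\eta(A^s)$. For $L$ recognized by $\eta$, $L^{\mathrm{sf}}=\{w\in\mathbb{S}_\eta^*\mid w \text{ stably-formed and } \mathrm{ev}(w)\in\eta(L)\}$, and $\mathbf{L}^{\mathrm{sf}}=\{L^{\mathrm{sf}}\mid L\in\mathbf{L}\}$ (as a multiset). For a class $\mathscr{D}$, $(L_1,\mathbf{L}_2)$ over alphabet $B$ is $\mathscr{D}$-coverable if there is a finite set $\mathbf{K}\subseteq\mathscr{D}(B)$ with $L_1\subseteq\bigcup_{K\in\mathbf{K}}K$ and every $K\in\mathbf{K}$ disjoint from some $L\in\mathbf{L}_2$. *)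

theory Defs
  imports "HOL-Algebra.Group" "HOL-Library.Multiset"
begin

text \<open>
  A class of languages assigns languages to \<^emph>\<open>all\<close> alphabets, and the statement applies
  one and the same class to \<open>A\<close>, to \<open>A\<^sub>d\<close> and to \<open>\<bbbS>\<^sub>\<eta>\<close>. So all alphabets are taken to be finite
  sets of elements of one type, closed under the two alphabet constructions:
  \<open>Block u\<close> is the word \<open>u\<close> seen as a single letter, \<open>Elem x\<close> is the letter \<open>(x)\<close>
  attached to the monoid element \<open>x\<close>. The alphabet \<open>A\<close> itself is an arbitrary finite set of
  letters of this type, not necessarily atoms.
\<close>

datatype ('a, 'm) letter =
    Atom 'a
  | Block "('a, 'm) letter list"
  | Elem (elem_val: 'm)

definition word_monoid :: "'c set \<Rightarrow> 'c list monoid" where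
  "word_monoid A = \<lparr>carrier = lists A, monoid.mult = (@), one = []\<rparr>"

text \<open>The library's \<open>hom\<close> does not require preservation of the neutral element.\<close>

definition monoid_morphism ::
  "('c, 'p) monoid_scheme \<Rightarrow> ('d, 'q) monoid_scheme \<Rightarrow> ('c \<Rightarrow> 'd) \<Rightarrow> bool" where
  "monoid_morphism G H h \<longleftrightarrow> h \<in> hom G H \<and> h \<one>\<^bsub>G\<^esub> = \<one>\<^bsub>H\<^esub>"

definition recognizes :: "'c set \<Rightarrow> ('c list \<Rightarrow> 'm) \<Rightarrow> 'c list set \<Rightarrow> bool" where
  "recognizes A \<eta> L \<longleftrightarrow> L = {w \<in> lists A. \<eta> w \<in> \<eta> ` L}"

inductive regular :: "'c set \<Rightarrow> 'c list set \<Rightarrow> bool" for A where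
  empty: "regular A {}"
| eps: "regular A {[]}"
| letter: "a \<in> A \<Longrightarrow> regular A {[a]}"
| union: "regular A K \<Longrightarrow> regular A L \<Longrightarrow> regular A (K \<union> L)"
| conc: "regular A K \<Longrightarrow> regular A L \<Longrightarrow> regular A {u @ v | u v. u \<in> K \<and> v \<in> L}"
| star: "regular A L \<Longrightarrow> regular A (concat ` lists L)"

type_synonym 'c lang_class = "'c set \<Rightarrow> 'c list set set"

definition is_class :: "'c lang_class \<Rightarrow> bool" where
  "is_class \<C> \<longleftrightarrow> (\<forall>A. finite A \<longrightarrow> (\<forall>L\<in>\<C> A. regular A L))"

definition closed_inv_length_increasing :: "'c lang_class \<Rightarrow> bool" where
  "closed_inv_length_increasing \<C> \<longleftrightarrow>
     (\<forall>A B \<alpha>. finite A \<longrightarrow> finite B \<longrightarrow>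
        monoid_morphism (word_monoid A) (word_monoid B) \<alpha> \<longrightarrow> (\<forall>a\<in>A. \<alpha> [a] \<noteq> []) \<longrightarrow>
        (\<forall>L\<in>\<C> B. {w \<in> lists A. \<alpha> w \<in> L} \<in> \<C> A))"

text \<open>\<open>coverable \<K> L\<^sub>1 \<L>\<^sub>2\<close> is coverability for the set \<open>\<K>\<close> of languages, to be
  instantiated with \<open>\<D> B\<close> for a class \<open>\<D>\<close> and an alphabet \<open>B\<close>.\<close>

definition coverable :: "'c list set set \<Rightarrow> 'c list set \<Rightarrow> 'c list set multiset \<Rightarrow> bool" where
  "coverable \<K> L\<^sub>1 \<L>\<^sub>2 \<longleftrightarrow>
     (\<exists>\<F>. finite \<F> \<and> \<F> \<subseteq> \<K> \<and> L\<^sub>1 \<subseteq> \<Union>\<F> \<and> (\<forall>K\<in>\<F>. \<exists>L\<in>#\<L>\<^sub>2. K \<inter> L = {}))"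

definition block_alphabet :: "nat \<Rightarrow> ('a, 'm) letter set \<Rightarrow> ('a, 'm) letter set" where
  "block_alphabet d A = {Block u | u. u \<in> lists A \<and> 1 \<le> length u \<and> length u \<le> d}"

text \<open>Only used for \<open>d \<ge> 1\<close>; the value at \<open>d = 0\<close> is there for termination.\<close>

function block_word :: "nat \<Rightarrow> ('a, 'm) letter list \<Rightarrow> ('a, 'm) letter list" where
  "block_word d w =
     (if d = 0 \<or> w = [] then [] else Block (take d w) # block_word d (drop d w))"
  by auto
termination by (relation "measure (\<lambda>(d, w). length w)") auto

declare block_word.simps [simp del]

definition block_class_at ::
  "nat \<Rightarrow> ('a, 'm) letter lang_class \<Rightarrow> ('a, 'm) letter lang_class" where
  "block_class_at d \<C> A = {{w \<in> lists A. block_word d w \<in> K} | K. K \<in> \<C> (block_alphabet d A)}"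

definition block_class :: "('a, 'm) letter lang_class \<Rightarrow> ('a, 'm) letter lang_class" where
  "block_class \<C> A = (\<Union>d\<in>{1..}. block_class_at d \<C> A)"

definition words_of_length :: "'c set \<Rightarrow> nat \<Rightarrow> 'c list set" where
  "words_of_length A n = {w \<in> lists A. length w = n}"

definition stability_index :: "'c set \<Rightarrow> ('c list \<Rightarrow> 'm) \<Rightarrow> nat" where
  "stability_index A \<eta> =
     (LEAST s. s \<ge> 1 \<and> \<eta> ` words_of_length A s = \<eta> ` words_of_length A (2 * s))"

definition sf_alphabet ::
  "('a, 'm) letter set \<Rightarrow> (('a, 'm) letter list \<Rightarrow> 'm) \<Rightarrow> ('a, 'm) letter set" where
  "sf_alphabet A \<eta> = Elem ` \<eta> ` (lists A - {[]})"

text \<open>\<open>elem_val\<close> is unspecified outside \<open>Elem\<close>; \<open>ev\<close> is only used on words over \<open>sf_alphabet\<close>.\<close>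

definition ev :: "('m, 'k) monoid_scheme \<Rightarrow> ('a, 'm) letter list \<Rightarrow> 'm" where
  "ev M w = foldr (\<lambda>c y. elem_val c \<otimes>\<^bsub>M\<^esub> y) w \<one>\<^bsub>M\<^esub>"

definition stably_formed ::
  "('a, 'm) letter set \<Rightarrow> (('a, 'm) letter list \<Rightarrow> 'm) \<Rightarrow> ('a, 'm) letter list \<Rightarrow> bool" where
  "stably_formed A \<eta> w \<longleftrightarrow> w \<in> lists (sf_alphabet A \<eta>) \<and>
     (\<forall>c\<in>set (butlast w). c \<in> Elem ` \<eta> ` words_of_length A (stability_index A \<eta>))"

definition sf_lang ::
  "('m, 'k) monoid_scheme \<Rightarrow> ('a, 'm) letter set \<Rightarrow> (('a, 'm) letter list \<Rightarrow> 'm) \<Rightarrow>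
     ('a, 'm) letter list set \<Rightarrow> ('a, 'm) letter list set" where
  "sf_lang M A \<eta> L = {w. stably_formed A \<eta> w \<and> ev M w \<in> \<eta> ` L}"

end

theory Submission
  imports Defs
begin

text \<open>
  Both nontrivial implications pull a cover back along a nonerasing morphism. For (3) to (2), map the
  letter \<open>u\<close> of \<open>A\<^sub>s\<close> to \<open>(\<eta>(u))\<close>; the composition with \<open>\<mu>\<^sub>s\<close> sends every word \<open>w\<close> to a
  stably-formed word of value \<open>\<eta>(w)\<close>. For (1) to (3), a finite cover involves finitely many block
  lengths \<open>d\<close>; let \<open>N\<close> be their product. Stability gives \<open>\<eta>(A\<^sup>s) = \<eta>(A\<^sup>s\<^sup>N)\<close>, so each
  letter \<open>(x)\<close> with \<open>x \<in> \<eta>(A\<^sup>s)\<close> can be replaced by a word of length \<open>sN\<close> and image \<open>x\<close>, and any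
  other letter by any nonempty word of image \<open>x\<close>. In a stably-formed word only the last
  replacement can have another length, so cutting the result into blocks of length \<open>d\<close> acts letter
  by letter, simultaneously for all the block lengths \<open>d\<close> of the cover.
\<close>

section \<open>Morphisms given by letter images, and coverability\<close>

lemma concat_map_in_lists:
  assumes "w \<in> lists A" "\<And>a. a \<in> A \<Longrightarrow> f a \<in> lists B"
  shows "concat (map f w) \<in> lists B"
  using assms by (induction w) auto

lemma monoid_morphism_concat_map:
  assumes "\<And>a. a \<in> A \<Longrightarrow> f a \<in> lists B"
  shows "monoid_morphism (word_monoid A) (word_monoid B) (\<lambda>w. concat (map f w))"
  using concat_map_in_lists[of _ A f B] assms
  unfolding monoid_morphism_def hom_def word_monoid_def by simp

text \<open>A morphism is determined by its letter images, so closure is restated for a letter map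
  \<open>f\<close>; both transfers of covers supply their morphism in this form.\<close>

lemma closed_inv_length_increasingD:
  assumes "closed_inv_length_increasing \<C>" "finite A" "finite B" "L \<in> \<C> B"
    and "\<And>a. a \<in> A \<Longrightarrow> f a \<in> lists B" "\<And>a. a \<in> A \<Longrightarrow> f a \<noteq> []"
  shows "{w \<in> lists A. concat (map f w) \<in> L} \<in> \<C> A"
proof -
  have "monoid_morphism (word_monoid A) (word_monoid B) (\<lambda>w. concat (map f w))"
    using assms(5) by (rule monoid_morphism_concat_map)
  moreover have "\<forall>a\<in>A. concat (map f [a]) \<noteq> []"
    using assms(6) by simp
  ultimately show ?thesis
    using assms(1-4) unfolding closed_inv_length_increasing_def by blast
qed

lemma coverableE:
  assumes "coverable \<K> L \<L>"
  obtains \<F> where "finite \<F>" "\<F> \<subseteq> \<K>" "L \<subseteq> \<Union>\<F>" "\<forall>K\<in>\<F>. \<exists>L'\<in>#\<L>. K \<inter> L' = {}"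
proof -
  from assms obtain \<F> where "finite \<F> \<and> \<F> \<subseteq> \<K> \<and> L \<subseteq> \<Union>\<F> \<and> (\<forall>K\<in>\<F>. \<exists>L'\<in>#\<L>. K \<inter> L' = {})"
    unfolding coverable_def ..
  then show ?thesis
    by (intro that[of \<F>]) simp_all
qed

lemma coverable_mono: "coverable \<K> L \<L> \<Longrightarrow> \<K> \<subseteq> \<K>' \<Longrightarrow> coverable \<K>' L \<L>"
  unfolding coverable_def by (meson subset_trans)

section \<open>Cutting words into blocks\<close>

lemma finite_block_alphabet:
  assumes "finite A"
  shows "finite (block_alphabet d A)"
proof -
  have "block_alphabet d A \<subseteq> Block ` {u. set u \<subseteq> A \<and> length u \<le> d}"
    unfolding block_alphabet_def lists_eq_set by blast
  then show ?thesis
    using finite_lists_length_le[OF assms] by (meson finite_imageI finite_subset)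
qed

lemma block_word_Nil [simp]: "block_word d [] = []"
  by (simp add: block_word.simps)

lemma block_word_neq_Nil:
  assumes "d > 0" "w \<noteq> []"
  shows "block_word d w \<noteq> []"
  unfolding block_word.simps[of d w] using assms by simp

lemma block_word_in_lists:
  assumes "w \<in> lists A"
  shows "block_word d w \<in> lists (block_alphabet d A)"
  using assms
proof (induction d w rule: block_word.induct)
  case (1 d w)
  show ?case
  proof (cases "d = 0 \<or> w = []")
    case False
    have "take d w \<in> lists A" "drop d w \<in> lists A"
      using "1.prems" by (auto dest: in_set_takeD in_set_dropD)
    then show ?thesis
      using "1.IH"[OF False] False
      by (subst block_word.simps) (auto simp: block_alphabet_def Suc_le_eq)
  qed (subst block_word.simps, auto)
qed

text \<open>All blocks of \<open>u\<close> are full, so the cutting restarts exactly at the first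
  letter of \<open>v\<close>.\<close>

lemma block_word_append:
  assumes "d dvd length u"
  shows "block_word d (u @ v) = block_word d u @ block_word d v"
  using assms
proof (induction d u rule: block_word.induct)
  case (1 d u)
  show ?case
  proof (cases "d = 0 \<or> u = []")
    case True
    then show ?thesis
      using "1.prems" by auto
  next
    case False
    then have "d \<le> length u"
      using "1.prems" by (simp add: dvd_imp_le)
    then have "d dvd length (drop d u)"
      using "1.prems" by simp
    from "1.IH"[OF False this] \<open>d \<le> length u\<close> False show ?thesis
      by (subst (1 2) block_word.simps) simp
  qed
qed

text \<open>The last factor may have any length because no later cut depends on it. This matches
  stably-formed words, whose last letter is unrestricted.\<close>

lemma block_word_concat:
  assumes "\<And>u. u \<in> set (butlast us) \<Longrightarrow> d dvd length u"
  shows "block_word d (concat us) = concat (map (block_word d) us)"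
  using assms
proof (induction us)
  case (Cons u us)
  then show ?case
    by (cases "us = []") (simp_all add: block_word_append)
qed simp

section \<open>Images of words of fixed length and the stability index\<close>

locale finite_morphism = monoid M for M :: "('m, 'k) monoid_scheme" (structure) +
  fixes A :: "('a, 'm) letter set" and \<eta> :: "('a, 'm) letter list \<Rightarrow> 'm"
  assumes finite_letters: "finite A"
    and finite_carrier: "finite (carrier M)"
    and morphism: "monoid_morphism (word_monoid A) M \<eta>"
begin

abbreviation images_at :: "nat \<Rightarrow> 'm set" where
  "images_at n \<equiv> \<eta> ` words_of_length A n"

abbreviation stab :: nat where
  "stab \<equiv> stability_index A \<eta>"

lemma image_Nil [simp]: "\<eta> [] = \<one>"
  using morphism by (simp add: monoid_morphism_def word_monoid_def)

lemma image_closed [simp]: "w \<in> lists A \<Longrightarrow> \<eta> w \<in> carrier M"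
  using morphism by (auto simp: monoid_morphism_def word_monoid_def hom_def)

lemma image_append [simp]:
  "u \<in> lists A \<Longrightarrow> v \<in> lists A \<Longrightarrow> \<eta> (u @ v) = \<eta> u \<otimes> \<eta> v"
  using morphism by (auto simp: monoid_morphism_def word_monoid_def hom_def)

lemma image_concat:
  assumes "us \<in> lists (lists A)"
  shows "\<eta> (concat us) = foldr (\<lambda>u y. \<eta> u \<otimes> y) us \<one>"
  using assms
proof (induction rule: lists.induct)
  case (Cons u us)
  then have "concat us \<in> lists A"
    unfolding lists_eq_set by auto
  then show ?case
    using Cons image_append[of u "concat us"] by simp
qed simp

text \<open>Splitting a word after \<open>m\<close> letters shows that the images at length
  \<open>m + n\<close> depend only on the image sets at \<open>m\<close> and at \<open>n\<close>.
  All stability arguments rest on this.\<close>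

lemma images_at_add:
  "images_at (m + n) = (\<lambda>(x, y). x \<otimes> y) ` (images_at m \<times> images_at n)" (is "?L = ?R")
proof (intro equalityI subsetI)
  fix x assume "x \<in> ?L"
  then obtain w where w: "w \<in> lists A" "length w = m + n" "x = \<eta> w"
    unfolding words_of_length_def by blast
  then have in_lists: "take m w \<in> lists A" "drop m w \<in> lists A"
    by (auto dest: in_set_takeD in_set_dropD)
  then have "\<eta> (take m w) \<in> images_at m" "\<eta> (drop m w) \<in> images_at n"
    using w(2) by (simp_all add: words_of_length_def)
  moreover have "x = \<eta> (take m w) \<otimes> \<eta> (drop m w)"
    using image_append[OF in_lists] w(3) by simp
  ultimately show "x \<in> ?R"
    by (intro rev_image_eqI[of "(\<eta> (take m w), \<eta> (drop m w))"]) simp_all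
next
  fix x assume "x \<in> ?R"
  then obtain u v where uv: "u \<in> words_of_length A m" "v \<in> words_of_length A n"
      and x: "x = \<eta> u \<otimes> \<eta> v"
    by (elim imageE SigmaE) simp
  then have "u @ v \<in> words_of_length A (m + n)"
    by (auto simp: words_of_length_def)
  moreover have "x = \<eta> (u @ v)"
    using uv x image_append[of u v] by (simp add: words_of_length_def)
  ultimately show "x \<in> ?L"
    by (rule rev_image_eqI)
qed

text \<open>The image sets are subsets of a finite monoid, so by pigeonhole their sequence is
  eventually periodic; a suitable multiple of the period is stable.\<close>

lemma ex_stable: "\<exists>s\<ge>1. images_at s = images_at (2 * s)"
proof -
  \<comment> \<open>The shift by \<open>Suc\<close> keeps the lengths positive, as the stable length
    found must be at least 1.\<close>
  have "range (\<lambda>n. images_at (Suc n)) \<subseteq> Pow (carrier M)"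
    using image_closed unfolding words_of_length_def by blast
  then have "finite (range (\<lambda>n. images_at (Suc n)))"
    using finite_carrier by (meson finite_Pow_iff finite_subset)
  then have "\<not> inj (\<lambda>n. images_at (Suc n))"
    using finite_imageD by blast
  then obtain i j where ij: "i < j" "images_at (Suc i) = images_at (Suc j)"
    unfolding inj_def by (metis nat_neq_iff)
  define p where "p = j - i"
  \<comment> \<open>An equality of image sets at two lengths survives adding the same number
    \<open>n - Suc i\<close> of letters to both.\<close>
  have period: "images_at (n + p) = images_at n" if "n \<ge> Suc i" for n
  proof -
    have "n + p = Suc j + (n - Suc i)" "n = Suc i + (n - Suc i)"
      using ij that by (auto simp: p_def)
    then show ?thesis
      using images_at_add[of "Suc j" "n - Suc i"] images_at_add[of "Suc i" "n - Suc i"] ij(2)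
      by simp
  qed
  have periods: "images_at (n + k * p) = images_at n" if "n \<ge> Suc i" for n k
  proof (induction k)
    case (Suc k)
    then show ?case
      using period[of "n + k * p"] that by (simp add: algebra_simps)
  qed simp
  \<comment> \<open>The length \<open>Suc i * p\<close> is a multiple of the period and at least
    \<open>Suc i\<close>, so doubling it adds only whole periods.\<close>
  have "p \<ge> 1"
    using ij by (simp add: p_def)
  then have "Suc i * p \<ge> Suc i"
    using mult_le_mono2[of 1 p "Suc i"] by simp
  then have "images_at (2 * (Suc i * p)) = images_at (Suc i * p)"
    unfolding mult_2 by (rule periods)
  moreover have "Suc i * p \<ge> 1"
    using \<open>p \<ge> 1\<close> by simp
  ultimately show ?thesis
    by metis
qed

lemma stab_pos: "stab \<ge> 1"
  and images_at_double_stab: "images_at stab = images_at (2 * stab)"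
  unfolding stability_index_def using LeastI_ex[OF ex_stable] by blast+

lemma images_at_stab_mult:
  assumes "n \<ge> 1"
  shows "images_at (stab * n) = images_at stab"
  using assms
proof (induction n rule: dec_induct)
  case (step n)
  have "images_at (stab * Suc n) = images_at (stab + stab * n)"
    by simp
  also have "\<dots> = images_at (stab + stab)"
    by (simp only: images_at_add step.IH)
  also have "\<dots> = images_at stab"
    by (simp only: images_at_double_stab mult_2)
  finally show ?case .
qed simp

section \<open>Stably-formed words and the transfer of covers from them\<close>

lemma finite_sf_alphabet: "finite (sf_alphabet A \<eta>)"
proof -
  have "sf_alphabet A \<eta> \<subseteq> Elem ` carrier M"
    using image_closed unfolding sf_alphabet_def by blast
  then show ?thesis
    using finite_carrier by (meson finite_imageI finite_subset)
qed

text \<open>Only the values on block letters matter; the second equation makes the function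
  total.\<close>

fun sf_letter :: "('a, 'm) letter \<Rightarrow> ('a, 'm) letter" where
  "sf_letter (Block u) = Elem (\<eta> u)"
| "sf_letter c = c"

definition sf_word :: "('a, 'm) letter list \<Rightarrow> ('a, 'm) letter list" where
  "sf_word w = map sf_letter (block_word stab w)"

lemma sf_letter_in_sf_alphabet:
  assumes "c \<in> block_alphabet stab A"
  shows "sf_letter c \<in> sf_alphabet A \<eta>"
proof -
  from assms obtain u where "c = Block u" "u \<in> lists A" "1 \<le> length u"
    unfolding block_alphabet_def by blast
  then have "u \<in> lists A - {[]}"
    by auto
  then show ?thesis
    using \<open>c = Block u\<close> unfolding sf_alphabet_def by simp
qed

lemma sf_word_eq_Cons:
  assumes "w \<noteq> []"
  shows "sf_word w = Elem (\<eta> (take stab w)) # sf_word (drop stab w)"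
  using stab_pos assms unfolding sf_word_def by (subst block_word.simps) simp

text \<open>Every block but possibly the last has length exactly \<open>stab\<close>; the induction
  peels off the first block.\<close>

lemma stably_formed_sf_word:
  assumes "w \<in> lists A"
  shows "stably_formed A \<eta> (sf_word w)"
proof -
  have "set (butlast (sf_word w)) \<subseteq> Elem ` images_at stab" if "w \<in> lists A" for w
    using that
  proof (induction w rule: length_induct)
    case (1 w)
    show ?case
    proof (cases "length w \<le> stab")
      case True
      \<comment> \<open>There is at most one block here, so \<open>butlast\<close> leaves nothing to
        check.\<close>
      then show ?thesis
        by (cases "w = []") (simp_all add: sf_word_eq_Cons, simp_all add: sf_word_def)
    next
      case False
      then have "w \<noteq> []"
        by auto
      have "drop stab w \<in> lists A" "take stab w \<in> lists A"
        using "1.prems" by (auto dest: in_set_takeD in_set_dropD)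
      moreover have "length (drop stab w) < length w"
        using \<open>w \<noteq> []\<close> stab_pos by simp
      ultimately have "set (butlast (sf_word (drop stab w))) \<subseteq> Elem ` images_at stab"
        using "1.IH" by blast
      moreover have "take stab w \<in> words_of_length A stab"
        using False \<open>take stab w \<in> lists A\<close> by (simp add: words_of_length_def)
      ultimately show ?thesis
        unfolding sf_word_eq_Cons[OF \<open>w \<noteq> []\<close>] by auto
    qed
  qed
  moreover have "sf_word w \<in> lists (sf_alphabet A \<eta>)"
    using block_word_in_lists[OF assms, of stab] sf_letter_in_sf_alphabet
    by (auto simp: sf_word_def)
  ultimately show ?thesis
    using assms unfolding stably_formed_def by blast
qed

lemma ev_sf_word:
  assumes "w \<in> lists A"
  shows "ev M (sf_word w) = \<eta> w"
  using assms
proof (induction w rule: length_induct)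
  case (1 w)
  show ?case
  proof (cases "w = []")
    case True
    then show ?thesis
      by (simp add: sf_word_def ev_def)
  next
    case False
    have in_lists: "drop stab w \<in> lists A" "take stab w \<in> lists A"
      using "1.prems" by (auto dest: in_set_takeD in_set_dropD)
    have "length (drop stab w) < length w"
      using False stab_pos by simp
    then have "ev M (sf_word w) = \<eta> (take stab w) \<otimes> \<eta> (drop stab w)"
      using "1.IH" in_lists False by (simp add: sf_word_eq_Cons ev_def)
    also have "\<dots> = \<eta> w"
      using image_append[OF in_lists(2,1)] by simp
    finally show ?thesis .
  qed
qed

text \<open>This is (3) to (2). The cover is pulled back along \<open>sf_word\<close>, which maps
  each \<open>L'\<close> into \<open>sf_lang M A \<eta> L'\<close>, so both covering and
  disjointness carry over.\<close>

lemma coverable_block_class_at_stab: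
  assumes closed: "closed_inv_length_increasing \<C>"
    and cov: "coverable (\<C> (sf_alphabet A \<eta>)) (sf_lang M A \<eta> L) (image_mset (sf_lang M A \<eta>) \<L>)"
    and L: "L \<subseteq> lists A"
  shows "coverable (block_class_at stab \<C> A) L \<L>"
proof -
  from cov obtain \<F> where \<F>: "finite \<F>" "\<F> \<subseteq> \<C> (sf_alphabet A \<eta>)" "sf_lang M A \<eta> L \<subseteq> \<Union>\<F>"
      "\<forall>K\<in>\<F>. \<exists>L'\<in>#image_mset (sf_lang M A \<eta>) \<L>. K \<inter> L' = {}"
    by (rule coverableE)
  define pull where "pull K = {w \<in> lists A. sf_word w \<in> K}" for K
  have sf_word_in: "sf_word w \<in> sf_lang M A \<eta> L'" if "w \<in> lists A" "w \<in> L'" for w L'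
    using that stably_formed_sf_word ev_sf_word by (simp add: sf_lang_def)
  have "pull K \<in> block_class_at stab \<C> A" if "K \<in> \<F>" for K
  proof -
    \<comment> \<open>The letter map is viewed as a morphism with one-letter images, hence length
      increasing.\<close>
    have "{v \<in> lists (block_alphabet stab A). concat (map (\<lambda>c. [sf_letter c]) v) \<in> K}
        \<in> \<C> (block_alphabet stab A)"
    proof (rule closed_inv_length_increasingD[OF closed])
      show "K \<in> \<C> (sf_alphabet A \<eta>)"
        using that \<F>(2) by (rule subsetD[rotated])
    qed (simp_all add: finite_block_alphabet finite_sf_alphabet finite_letters sf_letter_in_sf_alphabet)
    moreover have "pull K = {w \<in> lists A. block_word stab w \<in>
        {v \<in> lists (block_alphabet stab A). concat (map (\<lambda>c. [sf_letter c]) v) \<in> K}}"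
      unfolding pull_def sf_word_def using block_word_in_lists[of _ A stab]
      by (simp cong: conj_cong)
    ultimately show ?thesis
      unfolding block_class_at_def by blast
  qed
  moreover have "L \<subseteq> \<Union>(pull ` \<F>)"
  proof
    fix w assume w: "w \<in> L"
    then have "w \<in> lists A"
      using L by (rule subsetD[rotated])
    moreover obtain K where "K \<in> \<F>" "sf_word w \<in> K"
      using subsetD[OF \<F>(3) sf_word_in[OF calculation w]] by (rule UnionE)
    ultimately show "w \<in> \<Union>(pull ` \<F>)"
      by (auto simp: pull_def)
  qed
  moreover have "\<exists>L'\<in>#\<L>. pull K \<inter> L' = {}" if "K \<in> \<F>" for K
  proof -
    obtain L' where L': "L' \<in># \<L>" "K \<inter> sf_lang M A \<eta> L' = {}"
      using bspec[OF \<F>(4) \<open>K \<in> \<F>\<close>] unfolding set_image_mset bex_simps by (rule bexE)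
    have "pull K \<inter> L' = {}"
      using sf_word_in[of _ L'] L'(2) by (auto simp: pull_def disjoint_iff)
    then show ?thesis
      using L'(1) by (rule bexI)
  qed
  ultimately show ?thesis
    unfolding coverable_def using \<F>(1) by (intro exI[of _ "pull ` \<F>"]) auto
qed

section \<open>Transfer of covers to stably-formed words\<close>

text \<open>Letters with value in \<open>images_at stab\<close> get representatives of the common
  length \<open>stab * n\<close> by \<open>images_at_stab_mult\<close>; any other letter is the
  image of some nonempty word.\<close>

lemma ex_representatives:
  assumes "n \<ge> 1"
  obtains r where "\<And>c. c \<in> sf_alphabet A \<eta> \<Longrightarrow> r c \<in> lists A \<and> r c \<noteq> [] \<and> \<eta> (r c) = elem_val c"
    and "\<And>c. c \<in> Elem ` images_at stab \<Longrightarrow> length (r c) = stab * n"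
proof -
  have "\<exists>u. u \<in> lists A \<and> u \<noteq> [] \<and> \<eta> u = elem_val c \<and>
      (c \<in> Elem ` images_at stab \<longrightarrow> length u = stab * n)"
    if "c \<in> sf_alphabet A \<eta>" for c
  proof (cases "c \<in> Elem ` images_at stab")
    case True
    then have "elem_val c \<in> images_at (stab * n)"
      using images_at_stab_mult[OF assms] by auto
    moreover have "stab * n > 0"
      using stab_pos assms by simp
    ultimately show ?thesis
      by (force simp: words_of_length_def)
  next
    case False
    then show ?thesis
      using that by (auto simp: sf_alphabet_def)
  qed
  then obtain r where r: "\<forall>c\<in>sf_alphabet A \<eta>. r c \<in> lists A \<and> r c \<noteq> [] \<and> \<eta> (r c) = elem_val c \<and>
      (c \<in> Elem ` images_at stab \<longrightarrow> length (r c) = stab * n)"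
    by metis
  moreover have "Elem ` images_at stab \<subseteq> sf_alphabet A \<eta>"
  proof -
    have "words_of_length A stab \<subseteq> lists A - {[]}"
      using stab_pos by (auto simp: words_of_length_def)
    then show ?thesis
      unfolding sf_alphabet_def by blast
  qed
  ultimately show ?thesis
    using that[of r] by blast
qed

text \<open>This is (1) to (3). Substituting representatives turns a stably-formed word into a word
  over \<open>A\<close> of the same value, and commutes with cutting into blocks for every block
  length in the cover.\<close>

lemma coverable_sf_lang:
  assumes closed: "closed_inv_length_increasing \<C>"
    and cov: "coverable (block_class \<C> A) L \<L>"
    and L: "recognizes A \<eta> L" and \<L>: "\<forall>L'\<in>#\<L>. recognizes A \<eta> L'"
  shows "coverable (\<C> (sf_alphabet A \<eta>)) (sf_lang M A \<eta> L) (image_mset (sf_lang M A \<eta>) \<L>)"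
proof -
  from cov obtain \<F> where \<F>: "finite \<F>" "\<F> \<subseteq> block_class \<C> A" "L \<subseteq> \<Union>\<F>"
      "\<forall>K\<in>\<F>. \<exists>L'\<in>#\<L>. K \<inter> L' = {}"
    by (rule coverableE)
  \<comment> \<open>Different members of the cover may use different block lengths, so a length
    \<open>d K\<close> and a language \<open>H K\<close> over its block alphabet are chosen for each
    \<open>K\<close>.\<close>
  have "\<forall>K\<in>\<F>. \<exists>d. d \<ge> 1 \<and> K \<in> block_class_at d \<C> A"
    using \<F>(2) by (fastforce simp: block_class_def)
  from bchoice[OF this] obtain d where d: "\<forall>K\<in>\<F>. d K \<ge> 1 \<and> K \<in> block_class_at (d K) \<C> A" ..
  then have "\<forall>K\<in>\<F>. \<exists>H. H \<in> \<C> (block_alphabet (d K) A) \<and> K = {w \<in> lists A. block_word (d K) w \<in> H}"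
    unfolding block_class_at_def by blast
  from bchoice[OF this] obtain H where H: "\<forall>K\<in>\<F>. H K \<in> \<C> (block_alphabet (d K) A) \<and>
      K = {w \<in> lists A. block_word (d K) w \<in> H K}" ..
  \<comment> \<open>Finiteness of the cover gives a common multiple of all its block
    lengths.\<close>
  define N where "N = (\<Prod>K\<in>\<F>. d K)"
  have "N \<ge> 1"
    unfolding N_def using d prod_pos[of \<F> d] by (simp add: Suc_le_eq)
  then obtain r where
    r: "\<And>c. c \<in> sf_alphabet A \<eta> \<Longrightarrow> r c \<in> lists A \<and> r c \<noteq> [] \<and> \<eta> (r c) = elem_val c"
    and length_r: "\<And>c. c \<in> Elem ` images_at stab \<Longrightarrow> length (r c) = stab * N"
    by (rule ex_representatives) blast
  define g where "g v = concat (map r v)" for v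
  have g_in_lists: "g v \<in> lists A" if "v \<in> lists (sf_alphabet A \<eta>)" for v
    unfolding g_def using that by (rule concat_map_in_lists) (simp add: r)
  have image_g: "\<eta> (g v) = ev M v" if "v \<in> lists (sf_alphabet A \<eta>)" for v
  proof -
    have "map r v \<in> lists (lists A)"
      using that r by (induction v) auto
    then have "\<eta> (g v) = foldr (\<lambda>u y. \<eta> u \<otimes> y) (map r v) \<one>"
      unfolding g_def by (rule image_concat)
    also have "\<dots> = ev M v"
      using that r unfolding ev_def by (induction v) auto
    finally show ?thesis .
  qed
  \<comment> \<open>Since \<open>g\<close> preserves the value, recognition of \<open>L'\<close> by
    \<open>\<eta>\<close> turns equality of values into membership.\<close>
  have g_in: "g v \<in> L'" if "v \<in> sf_lang M A \<eta> L'" "recognizes A \<eta> L'" for v L'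
  proof -
    have "v \<in> lists (sf_alphabet A \<eta>)" "ev M v \<in> \<eta> ` L'"
      using that(1) by (simp_all add: sf_lang_def stably_formed_def)
    then have "g v \<in> {w \<in> lists A. \<eta> w \<in> \<eta> ` L'}"
      using g_in_lists image_g by simp
    then show ?thesis
      using equalityD2[OF that(2)[unfolded recognizes_def]] by (rule subsetD[rotated])
  qed
  \<comment> \<open>All factors but the last have length \<open>stab * N\<close>, a multiple of
    \<open>d K\<close>, so \<open>block_word_concat\<close> applies.\<close>
  have block_g: "block_word (d K) (g v) = concat (map (\<lambda>c. block_word (d K) (r c)) v)"
    if "K \<in> \<F>" "stably_formed A \<eta> v" for K v
  proof -
    have "d K dvd stab * N"
      unfolding N_def using \<F>(1) that(1) by (simp add: dvd_prodI)
    then have "block_word (d K) (concat (map r v)) = concat (map (block_word (d K)) (map r v))"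
      using that(2) length_r
      by (intro block_word_concat) (auto simp: stably_formed_def simp flip: map_butlast)
    then show ?thesis
      by (simp add: g_def comp_def)
  qed
  \<comment> \<open>The preimage is taken under a genuine morphism on all words over the alphabet;
    it agrees with cutting \<open>g v\<close> into blocks when \<open>v\<close> is stably-formed,
    which suffices because \<open>sf_lang\<close> contains only such words.\<close>
  define pull where
    "pull K = {v \<in> lists (sf_alphabet A \<eta>). concat (map (\<lambda>c. block_word (d K) (r c)) v) \<in> H K}" for K
  have "pull K \<in> \<C> (sf_alphabet A \<eta>)" if "K \<in> \<F>" for K
    unfolding pull_def
  proof (rule closed_inv_length_increasingD[OF closed finite_sf_alphabet finite_block_alphabet])
    show "H K \<in> \<C> (block_alphabet (d K) A)"
      using bspec[OF H that] by (rule conjunct1)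
    fix c assume "c \<in> sf_alphabet A \<eta>"
    note r = r[OF this]
    then show "block_word (d K) (r c) \<in> lists (block_alphabet (d K) A)"
      using block_word_in_lists by blast
    show "block_word (d K) (r c) \<noteq> []"
      using r d that by (intro block_word_neq_Nil) (auto simp: Suc_le_eq)
  qed (rule finite_letters)
  moreover have in_pull_iff: "v \<in> pull K \<longleftrightarrow> g v \<in> K" if "K \<in> \<F>" "stably_formed A \<eta> v" for K v
  proof -
    have v: "v \<in> lists (sf_alphabet A \<eta>)"
      using that(2) by (simp add: stably_formed_def)
    then have "v \<in> pull K \<longleftrightarrow> g v \<in> lists A \<and> block_word (d K) (g v) \<in> H K"
      using g_in_lists block_g[OF that] by (simp add: pull_def)
    then show ?thesis
      using eqset_imp_iff[OF conjunct2[OF bspec[OF H that(1)]], of "g v"] by simp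
  qed
  moreover have "sf_lang M A \<eta> L \<subseteq> \<Union>(pull ` \<F>)"
  proof
    fix v assume v: "v \<in> sf_lang M A \<eta> L"
    obtain K where "K \<in> \<F>" "g v \<in> K"
      using subsetD[OF \<F>(3) g_in[OF v L]] by (rule UnionE)
    then show "v \<in> \<Union>(pull ` \<F>)"
      using in_pull_iff v by (auto simp: sf_lang_def)
  qed
  moreover have "\<exists>L'\<in>#\<L>. pull K \<inter> sf_lang M A \<eta> L' = {}" if K: "K \<in> \<F>" for K
  proof -
    obtain L' where L': "L' \<in># \<L>" "K \<inter> L' = {}"
      using bspec[OF \<F>(4) K] ..
    have "v \<notin> pull K" if "v \<in> sf_lang M A \<eta> L'" for v
    proof -
      have "stably_formed A \<eta> v"
        using that by (simp add: sf_lang_def)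
      then show ?thesis
        using in_pull_iff[OF K] g_in[OF that] L' \<L> by (auto simp: disjoint_iff)
    qed
    then have "pull K \<inter> sf_lang M A \<eta> L' = {}"
      by (auto simp: disjoint_iff)
    then show ?thesis
      using L'(1) by (rule bexI)
  qed
  ultimately show ?thesis
    unfolding coverable_def using \<F>(1) by (intro exI[of _ "pull ` \<F>"]) auto
qed

end

theorem theorem7p3:
  fixes \<C> :: "('a, 'm) letter lang_class"
    and A :: "('a, 'm) letter set"
    and M :: "('m, 'k) monoid_scheme"
    and \<eta> :: "('a, 'm) letter list \<Rightarrow> 'm"
    and s :: nat
    and L\<^sub>1 :: "('a, 'm) letter list set"
    and \<L>\<^sub>2 :: "('a, 'm) letter list set multiset"
  assumes "is_class \<C>" and "closed_inv_length_increasing \<C>"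
    and "finite A"
    and "monoid M" and "finite (carrier M)"
    and "monoid_morphism (word_monoid A) M \<eta>"
    and "s = stability_index A \<eta>"
    and "recognizes A \<eta> L\<^sub>1" and "\<forall>L\<in>#\<L>\<^sub>2. recognizes A \<eta> L"
  shows "(coverable (block_class \<C> A) L\<^sub>1 \<L>\<^sub>2 \<longleftrightarrow> coverable (block_class_at s \<C> A) L\<^sub>1 \<L>\<^sub>2) \<and>
         (coverable (block_class_at s \<C> A) L\<^sub>1 \<L>\<^sub>2 \<longleftrightarrow>
            coverable (\<C> (sf_alphabet A \<eta>)) (sf_lang M A \<eta> L\<^sub>1) (image_mset (sf_lang M A \<eta>) \<L>\<^sub>2))"
proof -
  interpret finite_morphism M A \<eta>
    using assms by (simp add: finite_morphism_def finite_morphism_axioms_def)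
  have "L\<^sub>1 \<subseteq> lists A"
    using assms(8) unfolding recognizes_def by blast
  \<comment> \<open>This inclusion gives (2) to (1) and closes the cycle (1) to (3) to (2) to
    (1).\<close>
  moreover have "block_class_at s \<C> A \<subseteq> block_class \<C> A"
    using stab_pos assms(7) by (auto simp: block_class_def)
  ultimately show ?thesis
    using coverable_block_class_at_stab coverable_sf_lang coverable_mono assms by metis
qed

end
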